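(* Let $F$ be a CNF formula and let $m\ge 2$. If there is a treelike resolution refutation of $\mathrm{XOR}_m(F)$ of width $w$ and size $s$, then there is a resolution refutation of $F$ of width $\frac{w}{m-1}$ and depth $\log s$.
   Context: For a CNF $F$ over variables $x_1,\dots,x_n$, $\mathrm{XOR}_m(F)$ is obtained by substituting each $x_i$ by $y_{i,1}\oplus\cdots\oplus y_{i,m}$ with fresh variables $y_{i,j}$ and expanding each resulting constraint into its canonical CNF (a clause of width $w'$ becomes the $2^{(m-1)w'}$ clauses of width $mw'$ expressing it). A resolution refutation is a sequence of clauses ending in the empty clause, each an axiom or derived from earlier $C\lor x$, $D\lor\neg x$ as $C\lor D$; width is the maximum clause width, size the number of clauses, depth the number of edges on a longest path in the derivation DAG (edges from premises to derived clause). It is treelike if this DAG is a tree. Logarithms are base 2. *)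

theory Defs
  imports Complex_Main
begin

datatype 'v literal = Pos (atom: 'v) | Neg (atom: 'v)

type_synonym 'v clause = "'v literal set"
type_synonym 'v cnf = "'v clause set"

definition is_cnf :: "'v cnf \<Rightarrow> bool" where
  "is_cnf F \<longleftrightarrow> finite F \<and> (\<forall>C\<in>F. finite C)"

fun lit_true :: "('v \<Rightarrow> bool) \<Rightarrow> 'v literal \<Rightarrow> bool" where
  "lit_true \<alpha> (Pos x) \<longleftrightarrow> \<alpha> x"
| "lit_true \<alpha> (Neg x) \<longleftrightarrow> \<not> \<alpha> x"

definition clause_true :: "('v \<Rightarrow> bool) \<Rightarrow> 'v clause \<Rightarrow> bool" where
  "clause_true \<alpha> C \<longleftrightarrow> (\<exists>l\<in>C. lit_true \<alpha> l)"

text \<open>The clause over the variables \<open>V\<close> whose only falsifying assignment on \<open>V\<close> is \<open>\<alpha>\<close>.\<close>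

definition falsified_clause :: "'v set \<Rightarrow> ('v \<Rightarrow> bool) \<Rightarrow> 'v clause" where
  "falsified_clause V \<alpha> = (\<lambda>v. if \<alpha> v then Neg v else Pos v) ` V"

text \<open>The canonical CNF of a Boolean constraint \<open>P\<close> that depends only on the variables \<open>V\<close>:
  one full-width clause for each falsifying assignment.\<close>

definition canonical_cnf :: "'v set \<Rightarrow> (('v \<Rightarrow> bool) \<Rightarrow> bool) \<Rightarrow> 'v cnf" where
  "canonical_cnf V P = {falsified_clause V \<alpha> | \<alpha>. \<not> P \<alpha>}"

text \<open>The fresh variable \<open>y\<^sub>x\<^sub>,\<^sub>j\<close> is the pair \<open>(x, j)\<close> with \<open>j \<in> {1..m}\<close>. An assignment to these
  variables gives \<open>x\<close> the value of the parity of its block.\<close>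

definition xor_value :: "nat \<Rightarrow> ('v \<times> nat \<Rightarrow> bool) \<Rightarrow> 'v \<Rightarrow> bool" where
  "xor_value m \<alpha> x \<longleftrightarrow> odd (card {j \<in> {1..m}. \<alpha> (x, j)})"

text \<open>A tautological clause becomes a constraint without falsifying assignments, so it
  contributes no clauses.\<close>

definition xor_clause :: "nat \<Rightarrow> 'v clause \<Rightarrow> ('v \<times> nat) cnf" where
  "xor_clause m C =
     canonical_cnf (atom ` C \<times> {1..m}) (\<lambda>\<alpha>. clause_true (xor_value m \<alpha>) C)"

definition xor_cnf :: "nat \<Rightarrow> 'v cnf \<Rightarrow> ('v \<times> nat) cnf" where
  "xor_cnf m F = (\<Union>C\<in>F. xor_clause m C)"

text \<open>A line of a resolution proof is a clause with its justification; \<open>Resolve i j x\<close> resolves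
  lines \<open>i\<close> and \<open>j\<close> (counted from 0) on the variable \<open>x\<close>. The justifications fix the derivation
  DAG, whose nodes are the line numbers, so that equal clauses on different lines are different
  nodes.\<close>

datatype 'v justification = Axiom | Resolve nat nat 'v

type_synonym 'v res_proof = "('v clause \<times> 'v justification) list"

abbreviation line_clause :: "'v res_proof \<Rightarrow> nat \<Rightarrow> 'v clause" where
  "line_clause \<pi> k \<equiv> fst (\<pi> ! k)"

definition valid_line :: "'v cnf \<Rightarrow> 'v res_proof \<Rightarrow> nat \<Rightarrow> bool" where
  "valid_line F \<pi> k \<longleftrightarrow>
     (case snd (\<pi> ! k) of
        Axiom \<Rightarrow> line_clause \<pi> k \<in> F
      | Resolve i j x \<Rightarrow>
          i < k \<and> j < k \<and> Pos x \<in> line_clause \<pi> i \<and> Neg x \<in> line_clause \<pi> j \<and>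
          line_clause \<pi> k = (line_clause \<pi> i - {Pos x}) \<union> (line_clause \<pi> j - {Neg x}))"

definition refutation :: "'v cnf \<Rightarrow> 'v res_proof \<Rightarrow> bool" where
  "refutation F \<pi> \<longleftrightarrow>
     \<pi> \<noteq> [] \<and> (\<forall>k < length \<pi>. valid_line F \<pi> k) \<and> fst (last \<pi>) = {}"

fun premise_lines :: "'v justification \<Rightarrow> nat set" where
  "premise_lines Axiom = {}"
| "premise_lines (Resolve i j x) = {i, j}"

definition dag_edges :: "'v res_proof \<Rightarrow> (nat \<times> nat) set" where
  "dag_edges \<pi> = {(i, k). k < length \<pi> \<and> i \<in> premise_lines (snd (\<pi> ! k))}"

text \<open>Edges lead from smaller to larger line numbers, so the DAG of a refutation is a tree rooted
  at the last line iff every other line has exactly one outgoing edge.\<close>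

definition treelike :: "'v res_proof \<Rightarrow> bool" where
  "treelike \<pi> \<longleftrightarrow> (\<forall>i. Suc i < length \<pi> \<longrightarrow> (\<exists>!k. (i, k) \<in> dag_edges \<pi>))"

definition proof_width :: "'v res_proof \<Rightarrow> nat" where
  "proof_width \<pi> = Max ((\<lambda>(C, _). card C) ` set \<pi>)"

definition proof_size :: "'v res_proof \<Rightarrow> nat" where
  "proof_size \<pi> = length \<pi>"

definition proof_depth :: "'v res_proof \<Rightarrow> nat" where
  "proof_depth \<pi> = Max {d. \<exists>i k. (i, k) \<in> dag_edges \<pi> ^^ d}"

end

theory Submission
  imports Defs
begin

text \<open>Walk down the treelike refutation from the empty clause, always staying at a clause \<open>D\<close> that
  is falsified so far, and remember the value of \<open>x\<close> exactly while \<open>D\<close> mentions at least \<open>m - 1\<close>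
  of the variables \<open>(x, 1), \<dots>, (x, m)\<close>; at most \<open>w / (m - 1)\<close> values are remembered. If the
  value of \<open>x\<close> is remembered when \<open>(x, j)\<close> is resolved, answer consistently with it. Otherwise
  the answer is free and we move to the smaller subtree; if this makes \<open>x\<close> remembered, its value is
  queried. Every query thus halves the subtree. Read bottom-up, this strategy is a
  resolution refutation of \<open>F\<close>.\<close>

section \<open>Derivations of bounded width and depth\<close>

text \<open>The index \<open>d\<close> is only an upper bound on the depth: it is arbitrary at
  axioms and merely has to exceed the bounds of both premises at a resolution step. Without line
  numbers, derivations can be combined freely.\<close>

inductive derivable :: "'v cnf \<Rightarrow> nat \<Rightarrow> nat \<Rightarrow> 'v clause \<Rightarrow> bool" for F W where
  Axiom: "C \<in> F \<Longrightarrow> card C \<le> W \<Longrightarrow> derivable F W d C"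
| Resolve: "derivable F W d1 C \<Longrightarrow> derivable F W d2 D \<Longrightarrow> Pos x \<in> C \<Longrightarrow> Neg x \<in> D \<Longrightarrow>
    d1 < d \<Longrightarrow> d2 < d \<Longrightarrow> card ((C - {Pos x}) \<union> (D - {Neg x})) \<le> W \<Longrightarrow>
    derivable F W d ((C - {Pos x}) \<union> (D - {Neg x}))"

text \<open>\<open>h\<close> ranks the lines so that every edge of the DAG increases the rank.\<close>

definition ranked_proof :: "'v cnf \<Rightarrow> nat \<Rightarrow> nat \<Rightarrow> 'v res_proof \<Rightarrow> (nat \<Rightarrow> nat) \<Rightarrow> bool" where
  "ranked_proof F W B \<rho> h \<longleftrightarrow>
     (\<forall>k<length \<rho>. valid_line F \<rho> k \<and> card (line_clause \<rho> k) \<le> W \<and> h k \<le> B \<and>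
        (\<forall>i\<in>premise_lines (snd (\<rho> ! k)). h i < h k))"

lemma valid_line_append:
  assumes "k < length \<rho>" "valid_line F \<rho> k"
  shows "valid_line F (\<rho> @ \<sigma>) k"
  using assms by (auto simp: valid_line_def nth_append split: justification.splits)

lemma valid_line_premise_less:
  "valid_line F \<pi> k \<Longrightarrow> i \<in> premise_lines (snd (\<pi> ! k)) \<Longrightarrow> i < k"
  by (auto simp: valid_line_def split: justification.splits)

lemma ranked_proof_snoc:
  assumes "ranked_proof F W B \<rho> h" "valid_line F (\<rho> @ [(C, J)]) (length \<rho>)" "card C \<le> W" "v \<le> B"
    and "\<And>i. i \<in> premise_lines J \<Longrightarrow> h i < v"
  shows "ranked_proof F W B (\<rho> @ [(C, J)]) (h(length \<rho> := v))"
  unfolding ranked_proof_def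
proof (intro allI impI)
  fix k assume k: "k < length (\<rho> @ [(C, J)])"
  let ?h = "h(length \<rho> := v)"
  show "valid_line F (\<rho> @ [(C, J)]) k \<and> card (line_clause (\<rho> @ [(C, J)]) k) \<le> W \<and> ?h k \<le> B \<and>
      (\<forall>i\<in>premise_lines (snd ((\<rho> @ [(C, J)]) ! k)). ?h i < ?h k)"
  proof (cases "k < length \<rho>")
    case True
    then have "valid_line F \<rho> k" "card (line_clause \<rho> k) \<le> W" "h k \<le> B"
      and *: "\<And>i. i \<in> premise_lines (snd (\<rho> ! k)) \<Longrightarrow> h i < h k"
      using assms(1) by (auto simp: ranked_proof_def)
    moreover have "i \<noteq> length \<rho>" if "i \<in> premise_lines (snd (\<rho> ! k))" for i
      using valid_line_premise_less[OF \<open>valid_line F \<rho> k\<close> that] True by simp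
    ultimately show ?thesis
      using True by (auto simp: nth_append valid_line_append)
  next
    case False
    then have k: "k = length \<rho>" using k by simp
    have "i \<noteq> length \<rho>" if "i \<in> premise_lines J" for i
      using valid_line_premise_less[OF assms(2)] that by fastforce
    then show ?thesis using assms k by auto
  qed
qed

text \<open>The new lines go behind an arbitrary \<open>\<rho>\<close> because the second
  subderivation is written after the first. Keeping the ranks on \<open>\<rho>\<close> preserves the
  bound already known for the first premise.\<close>

lemma derivable_extend_ranked_proof:
  assumes "derivable F W d C" "ranked_proof F W B \<rho> h" "d \<le> B"
  shows "\<exists>\<sigma> h'. \<sigma> \<noteq> [] \<and> ranked_proof F W B (\<rho> @ \<sigma>) h' \<and> fst (last \<sigma>) = C \<and>
    h' (length (\<rho> @ \<sigma>) - 1) \<le> d \<and> (\<forall>k<length \<rho>. h' k = h k)"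
  using assms
proof (induction arbitrary: \<rho> h rule: derivable.induct)
  case (Axiom C d)
  have "ranked_proof F W B (\<rho> @ [(C, justification.Axiom)]) (h(length \<rho> := 0))"
    using Axiom by (intro ranked_proof_snoc) (auto simp: valid_line_def)
  then show ?case by (intro exI[of _ "[(C, justification.Axiom)]"] exI) auto
next
  case (Resolve d1 C d2 D x d)
  from Resolve.IH(1)[OF Resolve.prems(1)] Resolve.prems Resolve.hyps obtain \<sigma>1 h1 where
    1: "\<sigma>1 \<noteq> []" "ranked_proof F W B (\<rho> @ \<sigma>1) h1" "fst (last \<sigma>1) = C"
      "h1 (length (\<rho> @ \<sigma>1) - 1) \<le> d1" "\<forall>k<length \<rho>. h1 k = h k"
    by (meson less_imp_le order_trans)
  from Resolve.IH(2)[OF 1(2)] Resolve.prems Resolve.hyps obtain \<sigma>2 h2 where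
    2: "\<sigma>2 \<noteq> []" "ranked_proof F W B ((\<rho> @ \<sigma>1) @ \<sigma>2) h2" "fst (last \<sigma>2) = D"
      "h2 (length ((\<rho> @ \<sigma>1) @ \<sigma>2) - 1) \<le> d2" "\<forall>k<length (\<rho> @ \<sigma>1). h2 k = h1 k"
    by (meson less_imp_le order_trans)
  \<comment> \<open>Each subderivation ends with its premise, so the two premises sit on the last
    lines of \<open>\<sigma>1\<close> and \<open>\<sigma>2\<close>.\<close>
  define i where "i = length (\<rho> @ \<sigma>1) - 1"
  define j where "j = length (\<rho> @ \<sigma>1 @ \<sigma>2) - 1"
  define \<tau> where "\<tau> = \<rho> @ \<sigma>1 @ \<sigma>2"
  define E where "E = (C - {Pos x}) \<union> (D - {Neg x})"
  have len: "i < length (\<rho> @ \<sigma>1)" "i < length \<tau>" "j < length \<tau>"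
    using 1(1) 2(1) by (cases \<sigma>1; cases \<sigma>2; simp add: i_def j_def \<tau>_def)+
  have "\<tau> ! i = (\<rho> @ \<sigma>1) ! i"
    using len by (metis \<tau>_def append.assoc nth_append)
  also have "\<dots> = last \<sigma>1"
    using 1(1) by (metis i_def append_is_Nil_conv last_appendR last_conv_nth)
  finally have i: "line_clause \<tau> i = C" using 1(3) by simp
  have "\<tau> ! j = last \<sigma>2"
    using 2(1) by (metis \<tau>_def j_def append_is_Nil_conv last_appendR last_conv_nth)
  then have j: "line_clause \<tau> j = D" using 2(3) by simp
  have "h2 i = h1 i" using 2(5) len by simp
  then have h: "h2 i < d" "h2 j < d"
    using 1(4) 2(4) Resolve.hyps by (auto simp: i_def j_def)
  have "valid_line F (\<tau> @ [(E, justification.Resolve i j x)]) (length \<tau>)"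
    using i j len Resolve.hyps by (auto simp: valid_line_def nth_append E_def)
  then have "ranked_proof F W B (\<tau> @ [(E, justification.Resolve i j x)]) (h2(length \<tau> := d))"
    using 2(2) Resolve h by (intro ranked_proof_snoc) (auto simp: \<tau>_def E_def)
  then show ?case
    using 1(5) 2(5)
    by (intro exI[of _ "\<sigma>1 @ \<sigma>2 @ [(E, justification.Resolve i j x)]"] exI[of _ "h2(length \<tau> := d)"])
      (auto simp: \<tau>_def E_def fun_upd_def)
qed

text \<open>Every edge raises the rank by at least 1 and ranks of lines lie between 0 and
  \<open>d\<close>, so no path has more than \<open>d\<close> edges.\<close>

lemma derivable_empty_imp_refutation:
  assumes "derivable F W d {}"
  shows "\<exists>\<rho>. refutation F \<rho> \<and> proof_width \<rho> \<le> W \<and> proof_depth \<rho> \<le> d"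
proof -
  have "ranked_proof F W d [] (\<lambda>_. 0)" by (simp add: ranked_proof_def)
  from derivable_extend_ranked_proof[OF assms this] obtain \<rho> h where
    \<rho>: "\<rho> \<noteq> []" "ranked_proof F W d \<rho> h" "fst (last \<rho>) = {}" by auto
  have "refutation F \<rho>" using \<rho> by (auto simp: refutation_def ranked_proof_def)
  moreover have "proof_width \<rho> \<le> W"
    using \<rho> unfolding proof_width_def
    by (auto simp: ranked_proof_def in_set_conv_nth split: prod.splits) (metis fst_conv)
  moreover have "proof_depth \<rho> \<le> d"
  proof -
    let ?S = "{e. \<exists>i k. (i, k) \<in> dag_edges \<rho> ^^ e}"
    have path: "h i + e \<le> h k" if "(i, k) \<in> dag_edges \<rho> ^^ e" for i k e
      using that
    proof (induction e arbitrary: k)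
      case (Suc e)
      then obtain l where "(i, l) \<in> dag_edges \<rho> ^^ e" "(l, k) \<in> dag_edges \<rho>" by auto
      moreover from this have "h l < h k" using \<rho>(2) by (auto simp: dag_edges_def ranked_proof_def)
      ultimately show ?case using Suc.IH by fastforce
    qed simp
    have le: "e \<le> d" if path_e: "(i, k) \<in> dag_edges \<rho> ^^ e" for i k e
    \<comment> \<open>A path of length 0 may start and end at a number that is not a line, where the
      rank is not bounded; a last edge guarantees that \<open>k\<close> is a line.\<close>
    proof (cases e)
      case (Suc e')
      then obtain l where "(l, k) \<in> dag_edges \<rho>" using path_e by auto
      then have "h k \<le> d" using \<rho>(2) by (auto simp: dag_edges_def ranked_proof_def)
      then show ?thesis using path[OF path_e] by simp
    qed simp
    then have "finite ?S" by (auto intro!: finite_subset[of _ "{..d}"])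
    moreover have "0 \<in> ?S" by auto
    then have "?S \<noteq> {}" by blast
    ultimately show ?thesis using le unfolding proof_depth_def by (intro Max.boundedI) blast+
  qed
  ultimately show ?thesis by blast
qed

section \<open>Subtrees of a treelike proof\<close>

definition subproof :: "'v res_proof \<Rightarrow> nat \<Rightarrow> nat set" where
  "subproof \<pi> k = {i. (i, k) \<in> (dag_edges \<pi>)\<^sup>*}"

lemma dag_edges_less:
  "refutation F \<pi> \<Longrightarrow> (i, k) \<in> dag_edges \<pi> \<Longrightarrow> i < k"
  by (auto simp: dag_edges_def refutation_def intro: valid_line_premise_less)

lemma dag_path_le:
  assumes "refutation F \<pi>" "(i, k) \<in> (dag_edges \<pi>)\<^sup>*"
  shows "i \<le> k"
  using assms(2) by induction (use dag_edges_less[OF assms(1)] in fastforce)+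

lemma subproof_subset: "refutation F \<pi> \<Longrightarrow> subproof \<pi> k \<subseteq> {..k}"
  by (auto simp: subproof_def dest: dag_path_le)

lemma finite_subproof: "refutation F \<pi> \<Longrightarrow> finite (subproof \<pi> k)"
  using finite_subset[OF subproof_subset] by simp

lemma single_valued_dag_edges:
  assumes "refutation F \<pi>" "treelike \<pi>"
  shows "single_valued (dag_edges \<pi>)"
proof (rule single_valuedI)
  fix i k k' assume *: "(i, k) \<in> dag_edges \<pi>" "(i, k') \<in> dag_edges \<pi>"
  \<comment> \<open>A line with an outgoing edge is not the last one, so \<open>treelike\<close>
    applies to it.\<close>
  then have "Suc i < length \<pi>"
    using dag_edges_less[OF assms(1) *(1)] by (auto simp: dag_edges_def)
  then show "k = k'" using * assms(2) by (auto simp: treelike_def)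
qed

text \<open>The subtrees of two premises are disjoint: from a common line, unique successors would
  give a path from one premise to the other. That path would have to pass through \<open>k\<close>,
  which comes after both.\<close>

lemma card_subproof_premises:
  assumes "refutation F \<pi>" "treelike \<pi>" "(i, k) \<in> dag_edges \<pi>" "(j, k) \<in> dag_edges \<pi>" "i \<noteq> j"
  shows "card (subproof \<pi> i) + card (subproof \<pi> j) \<le> card (subproof \<pi> k)"
proof -
  have sv: "single_valued (dag_edges \<pi>)" using assms single_valued_dag_edges by blast
  have no_path: "(a, b) \<notin> (dag_edges \<pi>)\<^sup>*"
    if ak: "(a, k) \<in> dag_edges \<pi>" and bk: "(b, k) \<in> dag_edges \<pi>" and "a \<noteq> b" for a b
  proof
    assume "(a, b) \<in> (dag_edges \<pi>)\<^sup>*"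
    then obtain c where "(a, c) \<in> dag_edges \<pi>" "(c, b) \<in> (dag_edges \<pi>)\<^sup>*"
      using \<open>a \<noteq> b\<close> by (meson converse_rtranclE)
    then have "k \<le> b" using sv ak dag_path_le[OF assms(1)] by (metis single_valuedD)
    then show False using dag_edges_less[OF assms(1) bk] by simp
  qed
  have "subproof \<pi> i \<inter> subproof \<pi> j = {}"
  proof (rule ccontr)
    assume "subproof \<pi> i \<inter> subproof \<pi> j \<noteq> {}"
    then obtain u where "(u, i) \<in> (dag_edges \<pi>)\<^sup>*" "(u, j) \<in> (dag_edges \<pi>)\<^sup>*"
      by (auto simp: subproof_def)
    then have "(i, j) \<in> (dag_edges \<pi>)\<^sup>* \<or> (j, i) \<in> (dag_edges \<pi>)\<^sup>*"
      by (rule single_valued_confluent[OF sv])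
    then show False using no_path[of i j] no_path[of j i] assms(3-5) by blast
  qed
  then have "card (subproof \<pi> i) + card (subproof \<pi> j) = card (subproof \<pi> i \<union> subproof \<pi> j)"
    using finite_subproof[OF assms(1)] by (simp add: card_Un_disjoint)
  also have "\<dots> \<le> card (subproof \<pi> k)"
    using assms by (intro card_mono finite_subproof) (auto simp: subproof_def)
  finally show ?thesis .
qed

lemma card_subproof_premise:
  assumes "refutation F \<pi>" "(i, k) \<in> dag_edges \<pi>"
  shows "card (subproof \<pi> i) \<le> card (subproof \<pi> k)"
  using assms by (intro card_mono finite_subproof) (auto simp: subproof_def)

section \<open>Blocks of the substituted variables\<close>

definition block :: "nat \<Rightarrow> ('v \<times> nat) clause \<Rightarrow> 'v \<Rightarrow> nat set" where
  "block m D x = {j \<in> {1..m}. (x, j) \<in> atom ` D}"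

text \<open>The threshold is \<open>m - 1\<close> because below it at least two variables of the
  block are unset: after any further answer, one is still left to adjust the parity.\<close>

definition heavy :: "nat \<Rightarrow> ('v \<times> nat) clause \<Rightarrow> 'v set" where
  "heavy m D = {x. card (block m D x) \<ge> m - 1}"

text \<open>Exactly these clauses are falsifiable, so that they describe a partial
  assignment.\<close>

definition tautology_free :: "'v clause \<Rightarrow> bool" where
  "tautology_free D \<longleftrightarrow> (\<forall>v. \<not> (Pos v \<in> D \<and> Neg v \<in> D))"

text \<open>The variables made true by the assignment falsifying \<open>D\<close> are those occurring negatively.\<close>

definition compatible :: "nat \<Rightarrow> ('v \<times> nat) clause \<Rightarrow> ('v \<Rightarrow> bool) \<Rightarrow> bool" where
  "compatible m D \<beta> \<longleftrightarrow>
     (\<forall>x. block m D x = {1..m} \<longrightarrow> \<beta> x = xor_value m (\<lambda>v. Neg v \<in> D) x)"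

text \<open>The induction invariant. \<open>\<beta>\<close> is the state of the strategy, of which
  only the values on \<open>heavy m D\<close> are remembered, and \<open>t\<close> stands for the
  size of the subtree above \<open>D\<close>, so \<open>2 ^ d \<le> t\<close> is the logarithmic
  depth bound. Inclusion of \<open>C\<close> takes the place of a weakening rule.\<close>

definition covered :: "'v cnf \<Rightarrow> nat \<Rightarrow> nat \<Rightarrow> nat \<Rightarrow> ('v \<times> nat) clause \<Rightarrow> bool" where
  "covered F m W t D \<longleftrightarrow>
     (\<forall>\<beta>. compatible m D \<beta> \<longrightarrow>
        (\<exists>d C. derivable F W d C \<and> 2 ^ d \<le> t \<and> C \<subseteq> falsified_clause (heavy m D) \<beta>))"

lemma finite_block [simp]: "finite (block m D x)"
  by (simp add: block_def)

lemma block_mono: "D \<subseteq> E \<Longrightarrow> block m D x \<subseteq> block m E x"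
  by (auto simp: block_def)

lemma heavy_mono: "D \<subseteq> E \<Longrightarrow> heavy m D \<subseteq> heavy m E"
  by (auto simp: heavy_def intro: order_trans[OF _ card_mono[OF finite_block block_mono]])

lemma falsified_clause_mono: "V \<subseteq> V' \<Longrightarrow> falsified_clause V \<beta> \<subseteq> falsified_clause V' \<beta>"
  by (auto simp: falsified_clause_def)

lemma falsified_clause_iff:
  "l \<in> falsified_clause V \<alpha> \<longleftrightarrow> atom l \<in> V \<and> \<not> lit_true \<alpha> l"
  by (cases l) (auto simp: falsified_clause_def split: if_splits)

lemma atom_image_iff: "v \<in> atom ` D \<longleftrightarrow> Pos v \<in> D \<or> Neg v \<in> D"
proof
  assume "v \<in> atom ` D"
  then obtain l where "l \<in> D" "v = atom l" by blast
  then show "Pos v \<in> D \<or> Neg v \<in> D" by (cases l) auto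
qed (auto intro: rev_image_eqI)

text \<open>Double counting: the blocks of different variables are disjoint, and each heavy variable
  accounts for at least \<open>m - 1\<close> variables of \<open>D\<close>. This number is positive,
  so a heavy variable does occur in \<open>D\<close>.\<close>

lemma heavy_card_bound:
  assumes "finite D" "m \<ge> 2"
  shows "finite (heavy m D)" "card (heavy m D) * (m - 1) \<le> card D"
proof -
  have "heavy m D \<subseteq> fst ` atom ` D"
  proof
    fix x assume "x \<in> heavy m D"
    then have "block m D x \<noteq> {}" using assms(2) by (auto simp: heavy_def)
    then obtain j where "(x, j) \<in> atom ` D" unfolding block_def by blast
    then show "x \<in> fst ` atom ` D" by (metis fst_conv image_eqI)
  qed
  then show fin: "finite (heavy m D)" using assms(1) finite_subset by blast
  have "card (heavy m D) * (m - 1) \<le> (\<Sum>x\<in>heavy m D. card (block m D x))"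
    using sum_bounded_below[of "heavy m D" "m - 1" "\<lambda>x. card (block m D x)"]
    by (auto simp: heavy_def)
  also have "\<dots> = card (Sigma (heavy m D) (block m D))"
    using fin by (simp add: card_SigmaI)
  also have "\<dots> \<le> card (atom ` D)"
    using assms(1) by (intro card_mono) (auto simp: block_def)
  also have "\<dots> \<le> card D" using assms(1) by (rule card_image_le)
  finally show "card (heavy m D) * (m - 1) \<le> card D" .
qed

lemma xor_value_cong:
  assumes "\<And>j. j \<in> {1..m} \<Longrightarrow> \<alpha> (x, j) = \<beta> (x, j)"
  shows "xor_value m \<alpha> x = xor_value m \<beta> x"
proof -
  have "{j \<in> {1..m}. \<alpha> (x, j)} = {j \<in> {1..m}. \<beta> (x, j)}" using assms by blast
  then show ?thesis by (simp add: xor_value_def)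
qed

text \<open>A block that is full in \<open>D\<close> is full in \<open>E\<close>, and a
  tautology-free \<open>E\<close> adds no second literal on its variables, so the parity is the
  same.\<close>

lemma compatible_subset:
  assumes "compatible m E \<beta>" "D \<subseteq> E" "tautology_free E"
  shows "compatible m D \<beta>"
  unfolding compatible_def
proof (intro allI impI)
  fix x assume full: "block m D x = {1..m}"
  then have "block m E x = {1..m}"
    using block_mono[OF assms(2), of m x] by (auto simp: block_def)
  then have "\<beta> x = xor_value m (\<lambda>v. Neg v \<in> E) x" using assms(1) by (simp add: compatible_def)
  also have "\<dots> = xor_value m (\<lambda>v. Neg v \<in> D) x"
  proof (rule xor_value_cong)
    fix j assume "j \<in> {1..m}"
    then have "j \<in> block m D x" using full by simp
    then have "Pos (x, j) \<in> D \<or> Neg (x, j) \<in> D" by (simp add: block_def atom_image_iff)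
    then show "(Neg (x, j) \<in> E) = (Neg (x, j) \<in> D)"
      using assms(2,3) by (auto simp: tautology_free_def)
  qed
  finally show "\<beta> x = xor_value m (\<lambda>v. Neg v \<in> D) x" .
qed

text \<open>Used as weakening: a premise of a resolution step may be enlarged to the conclusion plus
  the resolved literal.\<close>

lemma covered_mono:
  assumes "covered F m W t D" "D \<subseteq> E" "t \<le> u" "tautology_free E"
  shows "covered F m W u E"
  unfolding covered_def
proof (intro allI impI)
  fix \<beta> assume "compatible m E \<beta>"
  then obtain d C where "derivable F W d C" "2 ^ d \<le> t" "C \<subseteq> falsified_clause (heavy m D) \<beta>"
    using compatible_subset assms by (metis covered_def)
  then show "\<exists>d C. derivable F W d C \<and> 2 ^ d \<le> u \<and> C \<subseteq> falsified_clause (heavy m E) \<beta>"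
    using falsified_clause_mono[OF heavy_mono[OF assms(2)]] assms(3) by (meson order_trans)
qed

section \<open>Setting one more variable: free and forced answers\<close>

lemma block_insert_other:
  "x \<noteq> fst (atom l) \<Longrightarrow> block m (insert l D) x = block m D x"
  by (cases "atom l") (auto simp: block_def)

lemma heavy_insert: "heavy m (insert l D) \<subseteq> insert (fst (atom l)) (heavy m D)"
  using block_insert_other by (fastforce simp: heavy_def)

lemma card_falsified_clause_subset:
  assumes "C \<subseteq> falsified_clause V \<beta>" "finite V"
  shows "card C \<le> card V"
  using assms unfolding falsified_clause_def
  by (meson card_image_le card_mono finite_imageI order_trans)

lemma xor_value_insert_other:
  "x \<noteq> fst (atom l) \<Longrightarrow>
    xor_value m (\<lambda>v. Neg v \<in> insert l D) x = xor_value m (\<lambda>v. Neg v \<in> D) x"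
  by (rule xor_value_cong) auto

text \<open>The block of \<open>x\<close> stays incomplete after \<open>l\<close> is added, so both
  values of \<open>x\<close> are compatible. The same subtree therefore supplies a clause for either
  value; resolving them on \<open>x\<close> is the query, and its one level of depth is paid for by
  \<open>2 * u \<le> t\<close>.\<close>

lemma covered_free_choice:
  assumes cov: "covered F m W u (insert l D)" and "2 * u \<le> t" and "fst (atom l) \<notin> heavy m D"
    and heavy: "finite (heavy m D)" "card (heavy m D) \<le> W"
  shows "covered F m W t D"
  unfolding covered_def
proof (intro allI impI)
  fix \<beta> assume \<beta>: "compatible m D \<beta>"
  define x where "x = fst (atom l)"
  let ?H = "falsified_clause (heavy m D) \<beta>"
  have x: "x \<notin> heavy m D" using assms by (simp add: x_def)
  have "block m (insert l D) x \<subseteq> insert (snd (atom l)) (block m D x)"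
    by (cases "atom l") (auto simp: block_def)
  then have "card (block m (insert l D) x) \<le> card (insert (snd (atom l)) (block m D x))"
    by (intro card_mono) auto
  also have "\<dots> \<le> Suc (card (block m D x))" by (simp add: card_insert_if)
  also have "\<dots> < m" using x by (auto simp: heavy_def)
  finally have not_full: "block m (insert l D) x \<noteq> {1..m}" by auto
  have "compatible m (insert l D) (\<beta>(x := b))" for b
    unfolding compatible_def
  proof (intro allI impI)
    fix z assume z: "block m (insert l D) z = {1..m}"
    then have "z \<noteq> x" using not_full by auto
    then show "(\<beta>(x := b)) z = xor_value m (\<lambda>v. Neg v \<in> insert l D) z"
      using z \<beta> block_insert_other[of z l m D] xor_value_insert_other[of z l m D]
      by (simp add: compatible_def x_def)
  qed
  then have "\<exists>d C. derivable F W d C \<and> 2 ^ d \<le> u \<and>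
      C \<subseteq> falsified_clause (heavy m (insert l D)) (\<beta>(x := b))" for b
    using cov by (simp add: covered_def)
  then have "\<exists>d C. derivable F W d C \<and> 2 ^ d \<le> u \<and>
      C \<subseteq> falsified_clause (insert x (heavy m D)) (\<beta>(x := b))" for b
    using falsified_clause_mono[OF heavy_insert[of m l D], folded x_def] by (meson subset_trans)
  then obtain d0 C0 d1 C1 where
    C0: "derivable F W d0 C0" "2 ^ d0 \<le> u"
      "C0 \<subseteq> falsified_clause (insert x (heavy m D)) (\<beta>(x := False))" and
    C1: "derivable F W d1 C1" "2 ^ d1 \<le> u"
      "C1 \<subseteq> falsified_clause (insert x (heavy m D)) (\<beta>(x := True))"
    by meson
  \<comment> \<open>As \<open>x\<close> is not heavy in \<open>D\<close>, the two falsified clauses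
    agree with \<open>?H\<close> except for one literal on \<open>x\<close>, the pivot.\<close>
  have sub: "l' \<in> ?H"
    if "l' \<in> falsified_clause (insert x (heavy m D)) (\<beta>(x := b))"
      "l' \<noteq> (if b then Neg x else Pos x)" for l' b
    using that x by (cases l') (auto simp: falsified_clause_iff split: if_splits)
  have sub0: "C0 - {Pos x} \<subseteq> ?H" using C0(3) sub[of _ False] by auto
  have sub1: "C1 - {Neg x} \<subseteq> ?H" using C1(3) sub[of _ True] by auto
  \<comment> \<open>If a clause lacks its pivot literal, it already serves for \<open>D\<close> and
    no query is made.\<close>
  consider "Pos x \<notin> C0" | "Neg x \<notin> C1" | "Pos x \<in> C0" "Neg x \<in> C1" by blast
  then show "\<exists>d C. derivable F W d C \<and> 2 ^ d \<le> t \<and> C \<subseteq> ?H"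
  proof cases
    case 1
    then show ?thesis using C0 sub0 assms(2)
      by (intro exI[of _ d0] exI[of _ C0]) auto
  next
    case 2
    then show ?thesis using C1 sub1 assms(2)
      by (intro exI[of _ d1] exI[of _ C1]) auto
  next
    case 3
    let ?C = "(C0 - {Pos x}) \<union> (C1 - {Neg x})"
    have C: "?C \<subseteq> ?H" using sub0 sub1 by blast
    then have "card ?C \<le> W" using card_falsified_clause_subset heavy by (meson order_trans)
    then have "derivable F W (Suc (max d0 d1)) ?C"
      using C0(1) C1(1) 3 by (intro derivable.Resolve) auto
    moreover have "(2::nat) ^ Suc (max d0 d1) \<le> t"
      using C0(2) C1(2) assms(2) by (cases "d0 \<le> d1") (auto simp: max_def)
    ultimately show ?thesis using C by blast
  qed
qed

text \<open>The two answers for \<open>y\<close> give the block of \<open>fst y\<close> opposite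
  parities, so one of them agrees with \<open>\<beta>\<close> should the block become full.\<close>

lemma compatible_insert_literal:
  assumes \<beta>: "compatible m D \<beta>" and y: "y \<notin> atom ` D"
  shows "compatible m (insert (Pos y) D) \<beta> \<or> compatible m (insert (Neg y) D) \<beta>"
proof -
  define x where "x = fst y"
  \<comment> \<open>No other block changes, so compatibility has to be checked at \<open>x\<close>
    only.\<close>
  have at_x: "compatible m (insert l D) \<beta>"
    if "atom l = y" "block m (insert l D) x = {1..m} \<Longrightarrow>
      \<beta> x = xor_value m (\<lambda>v. Neg v \<in> insert l D) x" for l
    unfolding compatible_def
  proof (intro allI impI)
    fix z assume z: "block m (insert l D) z = {1..m}"
    show "\<beta> z = xor_value m (\<lambda>v. Neg v \<in> insert l D) z"
    proof (cases "z = x")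
      case True
      then show ?thesis using that(2) z by blast
    next
      case False
      then have ne: "z \<noteq> fst (atom l)" using that(1) by (simp add: x_def)
      from z have "block m D z = {1..m}" unfolding block_insert_other[OF ne] .
      then show ?thesis
        using \<beta> unfolding xor_value_insert_other[OF ne] by (simp add: compatible_def)
    qed
  qed
  show ?thesis
  proof (cases "snd y \<in> {1..m}")
    case True
    let ?N = "\<lambda>D. {j \<in> {1..m}. Neg (x, j) \<in> D}"
    have "?N (insert (Neg y) D) = insert (snd y) (?N D)"
      using True by (cases y) (auto simp: x_def)
    moreover have "snd y \<notin> ?N D" using y by (auto simp: x_def atom_image_iff)
    ultimately have "card (?N (insert (Neg y) D)) = Suc (card (?N D))" by simp
    moreover have "?N (insert (Pos y) D) = ?N D" by auto
    ultimately have "xor_value m (\<lambda>v. Neg v \<in> insert (Neg y) D) x \<noteq>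
        xor_value m (\<lambda>v. Neg v \<in> insert (Pos y) D) x"
      by (simp add: xor_value_def)
    then consider "\<beta> x = xor_value m (\<lambda>v. Neg v \<in> insert (Pos y) D) x"
      | "\<beta> x = xor_value m (\<lambda>v. Neg v \<in> insert (Neg y) D) x" by blast
    then show ?thesis
    proof cases
      case 1
      then have "compatible m (insert (Pos y) D) \<beta>" by (intro at_x) simp_all
      then show ?thesis ..
    next
      case 2
      then have "compatible m (insert (Neg y) D) \<beta>" by (intro at_x) simp_all
      then show ?thesis ..
    qed
  next
    \<comment> \<open>An index outside \<open>{1..m}\<close> belongs to no block; setting
      \<open>y\<close> changes neither a block nor its parity.\<close>
    case False
    then have "block m (insert (Pos y) D) x = block m D x" by (auto simp: block_def)
    moreover have "xor_value m (\<lambda>v. Neg v \<in> insert (Pos y) D) x = xor_value m (\<lambda>v. Neg v \<in> D) x"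
      by (rule xor_value_cong) auto
    ultimately have "compatible m (insert (Pos y) D) \<beta>"
      using \<beta> by (intro at_x) (simp_all add: compatible_def)
    then show ?thesis ..
  qed
qed

text \<open>The variable is already remembered, so no new one becomes heavy. The clause obtained for
  the answer consistent with \<open>\<beta>\<close> is reused unchanged, at no cost in
  depth.\<close>

lemma covered_forced_choice:
  assumes "covered F m W t (insert (Pos y) D)" "covered F m W t (insert (Neg y) D)"
    and "y \<notin> atom ` D" and "fst y \<in> heavy m D"
  shows "covered F m W t D"
  unfolding covered_def
proof (intro allI impI)
  fix \<beta> assume "compatible m D \<beta>"
  then obtain l where l: "atom l = y" "compatible m (insert l D) \<beta>" "covered F m W t (insert l D)"
    using compatible_insert_literal[OF _ assms(3)] assms(1,2) by (meson literal.sel)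
  have "heavy m (insert l D) \<subseteq> heavy m D" using heavy_insert[of m l D] assms(4) l(1) by auto
  then have "falsified_clause (heavy m (insert l D)) \<beta> \<subseteq> falsified_clause (heavy m D) \<beta>"
    by (rule falsified_clause_mono)
  moreover obtain d C where "derivable F W d C" "2 ^ d \<le> t"
    "C \<subseteq> falsified_clause (heavy m (insert l D)) \<beta>"
    using l(2,3) unfolding covered_def by blast
  ultimately show "\<exists>d C. derivable F W d C \<and> 2 ^ d \<le> t \<and> C \<subseteq> falsified_clause (heavy m D) \<beta>"
    by blast
qed

lemma tautology_free_insert:
  assumes "tautology_free D" "atom l \<notin> atom ` D"
  shows "tautology_free (insert l D)"
  unfolding tautology_free_def
proof (intro allI notI)
  fix v assume v: "Pos v \<in> insert l D \<and> Neg v \<in> insert l D"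
  then have "l \<noteq> Pos v" "l \<noteq> Neg v" using assms(2) by (auto simp: atom_image_iff)
  then show False using v assms(1) by (auto simp: tautology_free_def)
qed

lemma covered_resolve:
  assumes "covered F m W t0 (insert (Pos y) D)" "covered F m W t1 (insert (Neg y) D)"
    and "t0 + t1 \<le> t" "y \<notin> atom ` D" "tautology_free D"
    and "finite (heavy m D)" "card (heavy m D) \<le> W"
  shows "covered F m W t D"
proof (cases "fst y \<in> heavy m D")
  case True
  have "covered F m W t (insert (Pos y) D)"
    by (rule covered_mono[OF assms(1) subset_refl])
      (use assms(3-5) in \<open>simp_all add: tautology_free_insert\<close>)
  moreover have "covered F m W t (insert (Neg y) D)"
    by (rule covered_mono[OF assms(2) subset_refl])
      (use assms(3-5) in \<open>simp_all add: tautology_free_insert\<close>)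
  ultimately show ?thesis using assms(4) True by (rule covered_forced_choice)
next
  case False
  \<comment> \<open>The smaller of the two subtrees has at most half the size, and a free answer may
    lead to either.\<close>
  consider "2 * t0 \<le> t" | "2 * t1 \<le> t" using assms(3) by linarith
  then show ?thesis
  proof cases
    case 1
    then show ?thesis using covered_free_choice[OF assms(1)] False assms by simp
  next
    case 2
    then show ?thesis using covered_free_choice[OF assms(2)] False assms by simp
  qed
qed

text \<open>\<open>D\<close> contains the full block of every variable of \<open>C\<close>.
  Compatibility thus forces \<open>\<beta>\<close> to take the block parities under
  \<open>\<alpha>\<close>, which falsify \<open>C\<close>.\<close>

lemma covered_axiom:
  assumes D: "D \<in> xor_cnf m F" and "m \<ge> 2"
    and heavy: "finite (heavy m D)" "card (heavy m D) \<le> W"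
  shows "covered F m W 1 D"
  unfolding covered_def
proof (intro allI impI)
  fix \<beta> assume \<beta>: "compatible m D \<beta>"
  obtain C \<alpha> where C: "C \<in> F" "D = falsified_clause (atom ` C \<times> {1..m}) \<alpha>"
    "\<not> clause_true (xor_value m \<alpha>) C"
    using D by (auto simp: xor_cnf_def xor_clause_def canonical_cnf_def)
  have "C \<subseteq> falsified_clause (heavy m D) \<beta>"
  proof
    fix l assume l: "l \<in> C"
    have lits: "Neg (atom l, j) \<in> D \<longleftrightarrow> \<alpha> (atom l, j)"
      "Pos (atom l, j) \<in> D \<longleftrightarrow> \<not> \<alpha> (atom l, j)" if "j \<in> {1..m}" for j
      using l that by (auto simp: C(2) falsified_clause_iff)
    have full: "block m D (atom l) = {1..m}" using lits by (auto simp: block_def atom_image_iff)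
    then have "\<beta> (atom l) = xor_value m (\<lambda>v. Neg v \<in> D) (atom l)"
      using \<beta> by (simp add: compatible_def)
    also have "\<dots> = xor_value m \<alpha> (atom l)" using lits by (intro xor_value_cong) simp
    finally have "\<not> lit_true \<beta> l" using C(3) l by (cases l) (auto simp: clause_true_def)
    moreover have "atom l \<in> heavy m D" using full by (simp add: heavy_def)
    ultimately show "l \<in> falsified_clause (heavy m D) \<beta>" by (simp add: falsified_clause_iff)
  qed
  moreover from this have "derivable F W 0 C"
    using C(1) card_falsified_clause_subset heavy by (meson derivable.Axiom order_trans)
  ultimately show "\<exists>d C. derivable F W d C \<and> 2 ^ d \<le> (1::nat) \<and> C \<subseteq> falsified_clause (heavy m D) \<beta>"
    by (intro exI[of _ 0] exI[of _ C]) simp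
qed

section \<open>Simulating the treelike refutation\<close>

lemma finite_xor_cnf_clause: "is_cnf F \<Longrightarrow> D \<in> xor_cnf m F \<Longrightarrow> finite D"
  by (auto simp: is_cnf_def xor_cnf_def xor_clause_def canonical_cnf_def falsified_clause_def)

lemma finite_line_clause:
  assumes "refutation F \<pi>" "\<And>C. C \<in> F \<Longrightarrow> finite C" "k < length \<pi>"
  shows "finite (line_clause \<pi> k)"
  using assms(3)
proof (induction k rule: less_induct)
  case (less k)
  then have "valid_line F \<pi> k" using assms(1) by (simp add: refutation_def)
  then show ?case
    using less assms(2) by (auto simp: valid_line_def split: justification.splits)
qed

text \<open>Restricting to tautology-free lines suffices: the empty clause is one, and every premise
  to which the induction hypothesis is applied lies in a tautology-free clause.\<close>

lemma covered_line:
  assumes ref: "refutation (xor_cnf m F) \<pi>" and tree: "treelike \<pi>" and "m \<ge> 2"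
    and heavy: "\<And>k. k < length \<pi> \<Longrightarrow>
      finite (heavy m (line_clause \<pi> k)) \<and> card (heavy m (line_clause \<pi> k)) \<le> W"
    and "k < length \<pi>" "tautology_free (line_clause \<pi> k)"
  shows "covered F m W (card (subproof \<pi> k)) (line_clause \<pi> k)"
  using assms(5,6)
proof (induction k rule: less_induct)
  case (less k)
  let ?D = "line_clause \<pi> k"
  note taut = less.prems(2)
  have valid: "valid_line (xor_cnf m F) \<pi> k"
    using ref less.prems by (simp add: refutation_def)
  show ?case
  proof (cases "snd (\<pi> ! k)")
    case Axiom
    then have "?D \<in> xor_cnf m F" using valid by (simp add: valid_line_def)
    then have "covered F m W 1 ?D"
      using covered_axiom heavy less.prems(1) assms(3) by blast
    moreover have "k \<in> subproof \<pi> k" by (simp add: subproof_def)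
    then have "1 \<le> card (subproof \<pi> k)"
      using finite_subproof[OF ref, of k] by (metis One_nat_def Suc_leI card_gt_0_iff empty_iff)
    ultimately show ?thesis using covered_mono taut by blast
  next
    case (Resolve i j y)
    then have ij: "i < k" "j < k" "Pos y \<in> line_clause \<pi> i" "Neg y \<in> line_clause \<pi> j"
      and D: "?D = (line_clause \<pi> i - {Pos y}) \<union> (line_clause \<pi> j - {Neg y})"
      using valid by (auto simp: valid_line_def)
    have edges: "(i, k) \<in> dag_edges \<pi>" "(j, k) \<in> dag_edges \<pi>"
      using Resolve less.prems by (auto simp: dag_edges_def)
    have sub_i: "line_clause \<pi> i \<subseteq> insert (Pos y) ?D" and sub_j: "line_clause \<pi> j \<subseteq> insert (Neg y) ?D"
      unfolding D by auto
    have premise: "covered F m W (card (subproof \<pi> p)) E"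
      if "p < k" "line_clause \<pi> p \<subseteq> E" "tautology_free E" for p E
    proof -
      have "tautology_free (line_clause \<pi> p)"
        using that(2,3) by (auto simp: tautology_free_def)
      then show ?thesis using less.IH[OF that(1)] less.prems(1) that covered_mono
        by (meson order.strict_trans order_refl)
    qed
    \<comment> \<open>A resolved literal can survive because the other premise may contain it too.
      Then one premise is already a subset of \<open>?D\<close>, and weakening is enough.\<close>
    consider "Pos y \<in> ?D" | "Neg y \<in> ?D" | "y \<notin> atom ` ?D" by (auto simp: atom_image_iff)
    then show ?thesis
    proof cases
      case 1
      then have "covered F m W (card (subproof \<pi> i)) ?D"
        using premise[OF ij(1)] sub_i taut by (simp add: insert_absorb)
      then show ?thesis using card_subproof_premise[OF ref edges(1)] taut covered_mono by blast
    next
      case 2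
      then have "covered F m W (card (subproof \<pi> j)) ?D"
        using premise[OF ij(2)] sub_j taut by (simp add: insert_absorb)
      then show ?thesis using card_subproof_premise[OF ref edges(2)] taut covered_mono by blast
    next
      case 3
      then have "Pos y \<notin> ?D" "Neg y \<notin> ?D" by (auto simp: atom_image_iff)
      \<comment> \<open>If \<open>i = j\<close>, that clause would contain both literals on
        \<open>y\<close> and the conclusion would keep both.\<close>
      then have "i \<noteq> j" using ij(3,4) D by auto
      have "tautology_free (insert (Pos y) ?D)" "tautology_free (insert (Neg y) ?D)"
        using 3 taut by (simp_all add: tautology_free_insert)
      then have "covered F m W (card (subproof \<pi> i)) (insert (Pos y) ?D)"
        "covered F m W (card (subproof \<pi> j)) (insert (Neg y) ?D)"
        using premise ij(1,2) sub_i sub_j by blast+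
      then show ?thesis
        using covered_resolve card_subproof_premises[OF ref tree edges \<open>i \<noteq> j\<close>] 3 taut
          heavy[OF less.prems(1)] by blast
    qed
  qed
qed

theorem mainTheorem8:
  fixes F :: "'v cnf" and m w s :: nat
  assumes "is_cnf F"
    and "m \<ge> 2"
    and "\<exists>\<pi>. refutation (xor_cnf m F) \<pi> \<and> treelike \<pi> \<and> proof_width \<pi> \<le> w \<and> proof_size \<pi> \<le> s"
  shows "\<exists>\<rho>. refutation F \<rho> \<and>
           real (proof_width \<rho>) \<le> real w / (real m - 1) \<and>
           real (proof_depth \<rho>) \<le> log 2 (real s)"
proof -
  obtain \<pi> where ref: "refutation (xor_cnf m F) \<pi>" and tree: "treelike \<pi>"
    and width: "proof_width \<pi> \<le> w" and size: "length \<pi> \<le> s"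
    using assms(3) by (auto simp: proof_size_def)
  \<comment> \<open>Widths are integers, so the bound may be rounded down.\<close>
  define W where "W = w div (m - 1)"
  have heavy: "finite (heavy m (line_clause \<pi> k)) \<and> card (heavy m (line_clause \<pi> k)) \<le> W"
    if k: "k < length \<pi>" for k
  proof -
    \<comment> \<open>Finiteness gives the width bound its meaning, since \<open>card\<close> is 0
      on infinite sets.\<close>
    have fin: "finite (line_clause \<pi> k)"
      using finite_line_clause[OF ref finite_xor_cnf_clause[OF assms(1)] k] .
    have "card (line_clause \<pi> k) \<in> (\<lambda>(C, _). card C) ` set \<pi>"
      using k by (auto simp: image_iff case_prod_beta intro!: bexI[of _ "\<pi> ! k"])
    then have "card (line_clause \<pi> k) \<le> w"
      using width unfolding proof_width_def by (meson List.finite_set Max_ge finite_imageI order_trans)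
    then have "card (heavy m (line_clause \<pi> k)) * (m - 1) \<le> w"
      using heavy_card_bound(2)[OF fin assms(2)] by simp
    then show ?thesis
      using heavy_card_bound(1)[OF fin assms(2)] assms(2)
      by (simp add: W_def less_eq_div_iff_mult_less_eq)
  qed
  define r where "r = length \<pi> - 1"
  have r: "r < length \<pi>" "line_clause \<pi> r = {}"
    using ref by (auto simp: refutation_def r_def last_conv_nth)
  have "covered F m W (card (subproof \<pi> r)) {}"
    using covered_line[OF ref tree assms(2) heavy r(1)] r(2) by (simp add: tautology_free_def)
  \<comment> \<open>The empty clause has no full block, so any starting assignment would do.\<close>
  moreover have "compatible m {} (\<lambda>x. False)"
    using assms(2) by (auto simp: compatible_def block_def)
  moreover have "heavy m {} = {}" using assms(2) by (auto simp: heavy_def block_def)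
  ultimately have "\<exists>d C. derivable F W d C \<and> 2 ^ d \<le> card (subproof \<pi> r) \<and>
      C \<subseteq> falsified_clause {} (\<lambda>x. False)"
    unfolding covered_def by metis
  \<comment> \<open>With no heavy variables the falsified clause is empty, hence so is
    \<open>C\<close>.\<close>
  then obtain d where d: "derivable F W d {}" "2 ^ d \<le> card (subproof \<pi> r)"
    by (auto simp: falsified_clause_def)
  have "card (subproof \<pi> r) \<le> Suc r"
    using card_mono[OF finite_atMost subproof_subset[OF ref, of r]] by simp
  then have s: "2 ^ d \<le> s" using d(2) r(1) size by simp
  from derivable_empty_imp_refutation[OF d(1)] obtain \<rho> where
    \<rho>: "refutation F \<rho>" "proof_width \<rho> \<le> W" "proof_depth \<rho> \<le> d" by blast
  have "real (proof_width \<rho>) \<le> real w / real (m - 1)"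
    using order_trans[OF of_nat_mono of_nat_div_le_of_nat] \<rho>(2) unfolding W_def .
  moreover have "real (proof_depth \<rho>) \<le> log 2 (real s)"
    using le_log2_of_power[OF s] \<rho>(3) by linarith
  ultimately show ?thesis using \<rho>(1) assms(2) by (auto simp: of_nat_diff)
qed

end
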